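(* Let $(B,\wedge,-,0,1)$ and $(B',\vee',-',0',1')$ be two Boolean algebras, let $A$ be a set, and let $r:A\to B$, $e:B\to A$, $r':A\to B'$, $e':B'\to A$ be maps such that $r\circ e=\mathrm{id}_B$ and $r'\circ e'=\mathrm{id}_{B'}$. Let $\mathbf A:=(A,\sqcap,\sqcup,\bar\neg,\lrcorner,e'(1'),e(0))$ be the algebra with $x\sqcap y:=e(r(x)\wedge r(y))$, $x\sqcup y:=e'(r'(x)\vee' r'(y))$, $\bar\neg x:=e(-r(x))$ and $\lrcorner x:=e'(-'r'(x))$, top constant $e'(1')$ and bottom constant $e(0)$. Then $\mathbf A$ is a double Boolean algebra if and only if the following hold: (a) $e\circ r\circ e'\circ r'=e'\circ r'\circ e\circ r$; (b) $e(r(x)\wedge r(e'(r'(x)\vee' r'(y))))=e(r(x))$ and $e'(r'(x)\vee' r'(e(r(x)\wedge r(y))))=e'(r'(x))$ for all $x,y\in A$; (c) $r(e'(1'))=1$ and $r'(e(0))=0'$. Moreover, every double Boolean algebra can be obtained from such a construction; that is, for every double Boolean algebra $\mathbf D$ with carrier $D$ there are Boolean algebras $(B,\wedge,-,0,1)$ and $(B',\vee',-',0',1')$ and maps $r:D\to B$, $e:B\to D$, $r':D\to B'$, $e':B'\to D$ with $r\circ e=\mathrm{id}_B$ and $r'\circ e'=\mathrm{id}_{B'}$, satisfying (a)–(c) with $A=D$, such that $\mathbf D$ is the resulting algebra $\mathbf A$, i.e. the operations of $\mathbf D$ are given by $x\sqcap y=e(r(x)\wedge r(y))$, $x\sqcup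 y=e'(r'(x)\vee' r'(y))$, $\bar\neg x=e(-r(x))$, $\lrcorner x=e'(-'r'(x))$, $\top=e'(1')$ and $\bot=e(0)$.
   Context: A double Boolean algebra (dBa) is an algebra $(D,\sqcup,\sqcap,\bar\neg,\lrcorner,\top,\bot)$ (with $\sqcup,\sqcap$ binary, $\bar\neg,\lrcorner$ unary, $\top,\bot$ constants) satisfying, for all $x,y,z\in D$, where $x\bar\vee y:=\bar\neg(\bar\neg x\sqcap\bar\neg y)$ and $x\bar\wedge y:=\lrcorner(\lrcorner x\sqcup\lrcorner y)$: (1a) $(x\sqcap x)\sqcap y=x\sqcap y$; (1b) $(x\sqcup x)\sqcup y=x\sqcup y$; (2a) $x\sqcap y=y\sqcap x$; (2b) $x\sqcup y=y\sqcup x$; (3a) $\bar\neg(x\sqcap x)=\bar\neg x$; (3b) $\lrcorner(x\sqcup x)=\lrcorner x$; (4a) $x\sqcap(x\sqcup y)=x\sqcap x$; (4b) $x\sqcup(x\sqcap y)=x\sqcup x$; (5a) $x\sqcap(y\bar\vee z)=(x\sqcap y)\bar\vee(x\sqcap z)$; (5b) $x\sqcup(y\bar\wedge z)=(x\sqcup y)\bar\wedge(x\sqcup z)$; (6a) $x\sqcap(x\bar\vee y)=x\sqcap x$; (6b) $x\sqcup(x\bar\wedge y)=x\sqcup x$; (7a) $\bar\neg\bar\neg(x\sqcap y)=x\sqcap y$; (7b) $\lrcorner\lrcorner(x\sqcup y)=x\sqcup y$; (8a) $x\sqcap\bar\neg x=\bot$; (8b) $x\sqcup\lrcorner x=\top$;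 (9a) $\bar\neg\top=\bot$; (9b) $\lrcorner\bot=\top$; (10a) $x\sqcap(y\sqcap z)=(x\sqcap y)\sqcap z$; (10b) $x\sqcup(y\sqcup z)=(x\sqcup y)\sqcup z$; (11a) $\bar\neg\bot=\top\sqcap\top$; (11b) $\lrcorner\top=\bot\sqcup\bot$; (12) $(x\sqcap x)\sqcup(x\sqcap x)=(x\sqcup x)\sqcap(x\sqcup x)$. In $(B,\wedge,-,0,1)$, $\wedge$ is meet, $-$ complement, $0$ and $1$ least and greatest elements; in $(B',\vee',-',0',1')$, $\vee'$ is join, $-'$ complement, $0'$ and $1'$ least and greatest elements. *)

theory Defs
  imports Main "HOL-Library.FuncSet"
begin

text \<open>
  Boolean algebras on an explicit carrier. The axioms are those of the library locale
  \<^locale>\<open>abstract_boolean_algebra\<close>, relativised to the carrier; the library locale and the type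
  class \<^class>\<open>boolean_algebra\<close> only cover algebras carried by a whole type. As there, the
  one-element algebra is allowed.
\<close>

locale boolean_algebra_on =
  fixes B :: "'b set"
    and meet :: "'b \<Rightarrow> 'b \<Rightarrow> 'b"  (infixr "\<^bold>\<and>" 70)
    and join :: "'b \<Rightarrow> 'b \<Rightarrow> 'b"  (infixr "\<^bold>\<or>" 65)
    and compl :: "'b \<Rightarrow> 'b"  ("\<^bold>- _" [81] 80)
    and zero :: 'b  ("\<^bold>0")
    and one :: 'b  ("\<^bold>1")
  assumes meet_closed: "x \<in> B \<Longrightarrow> y \<in> B \<Longrightarrow> x \<^bold>\<and> y \<in> B"
    and join_closed: "x \<in> B \<Longrightarrow> y \<in> B \<Longrightarrow> x \<^bold>\<or> y \<in> B"
    and compl_closed: "x \<in> B \<Longrightarrow> \<^bold>- x \<in> B"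
    and zero_closed: "\<^bold>0 \<in> B"
    and one_closed: "\<^bold>1 \<in> B"
    and meet_assoc: "x \<in> B \<Longrightarrow> y \<in> B \<Longrightarrow> z \<in> B \<Longrightarrow> (x \<^bold>\<and> y) \<^bold>\<and> z = x \<^bold>\<and> (y \<^bold>\<and> z)"
    and meet_commute: "x \<in> B \<Longrightarrow> y \<in> B \<Longrightarrow> x \<^bold>\<and> y = y \<^bold>\<and> x"
    and join_assoc: "x \<in> B \<Longrightarrow> y \<in> B \<Longrightarrow> z \<in> B \<Longrightarrow> (x \<^bold>\<or> y) \<^bold>\<or> z = x \<^bold>\<or> (y \<^bold>\<or> z)"
    and join_commute: "x \<in> B \<Longrightarrow> y \<in> B \<Longrightarrow> x \<^bold>\<or> y = y \<^bold>\<or> x"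
    and meet_join_distrib:
      "x \<in> B \<Longrightarrow> y \<in> B \<Longrightarrow> z \<in> B \<Longrightarrow> x \<^bold>\<and> (y \<^bold>\<or> z) = (x \<^bold>\<and> y) \<^bold>\<or> (x \<^bold>\<and> z)"
    and join_meet_distrib:
      "x \<in> B \<Longrightarrow> y \<in> B \<Longrightarrow> z \<in> B \<Longrightarrow> x \<^bold>\<or> (y \<^bold>\<and> z) = (x \<^bold>\<or> y) \<^bold>\<and> (x \<^bold>\<or> z)"
    and meet_one: "x \<in> B \<Longrightarrow> x \<^bold>\<and> \<^bold>1 = x"
    and join_zero: "x \<in> B \<Longrightarrow> x \<^bold>\<or> \<^bold>0 = x"
    and meet_compl: "x \<in> B \<Longrightarrow> x \<^bold>\<and> \<^bold>- x = \<^bold>0"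
    and join_compl: "x \<in> B \<Longrightarrow> x \<^bold>\<or> \<^bold>- x = \<^bold>1"

lemma boolean_algebra_on_UNIV_iff:
  "boolean_algebra_on UNIV meet join compl zero one \<longleftrightarrow>
   abstract_boolean_algebra meet join compl zero one"
  unfolding boolean_algebra_on_def abstract_boolean_algebra_def
    abstract_boolean_algebra_axioms_def abel_semigroup_def abel_semigroup_axioms_def
    semigroup_def
  by (simp only: UNIV_I simp_thms) blast

text \<open>
  Boolean algebras in the signatures $(B,\wedge,-,0,1)$ and $(B,\vee,-,0,1)$: the reducts obtained
  by dropping the (uniquely determined) join, respectively meet.
\<close>

definition meet_boolean_algebra ::
    "'b set \<Rightarrow> ('b \<Rightarrow> 'b \<Rightarrow> 'b) \<Rightarrow> ('b \<Rightarrow> 'b) \<Rightarrow> 'b \<Rightarrow> 'b \<Rightarrow> bool" where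
  "meet_boolean_algebra B meet compl zero one \<longleftrightarrow>
    (\<exists>join. boolean_algebra_on B meet join compl zero one)"

definition join_boolean_algebra ::
    "'b set \<Rightarrow> ('b \<Rightarrow> 'b \<Rightarrow> 'b) \<Rightarrow> ('b \<Rightarrow> 'b) \<Rightarrow> 'b \<Rightarrow> 'b \<Rightarrow> bool" where
  "join_boolean_algebra B join compl zero one \<longleftrightarrow>
    (\<exists>meet. boolean_algebra_on B meet join compl zero one)"

text \<open>\<open>neg\<close> is the negation belonging to the meet, \<open>opp\<close> the one belonging to the join.\<close>

locale double_boolean_signature =
  fixes D :: "'d set"
    and meet :: "'d \<Rightarrow> 'd \<Rightarrow> 'd"  (infixl "\<sqinter>" 70)
    and join :: "'d \<Rightarrow> 'd \<Rightarrow> 'd"  (infixl "\<squnion>" 65)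
    and neg :: "'d \<Rightarrow> 'd"
    and opp :: "'d \<Rightarrow> 'd"
    and top :: 'd  ("\<top>")
    and bot :: 'd  ("\<bottom>")
begin

abbreviation meet_vee :: "'d \<Rightarrow> 'd \<Rightarrow> 'd"  (infixl "\<^bold>\<or>" 65) where
  "x \<^bold>\<or> y \<equiv> neg (neg x \<sqinter> neg y)"

abbreviation join_wedge :: "'d \<Rightarrow> 'd \<Rightarrow> 'd"  (infixl "\<^bold>\<and>" 70) where
  "x \<^bold>\<and> y \<equiv> opp (opp x \<squnion> opp y)"

end

locale double_boolean_algebra = double_boolean_signature +
  assumes meet_closed: "x \<in> D \<Longrightarrow> y \<in> D \<Longrightarrow> x \<sqinter> y \<in> D"
    and join_closed: "x \<in> D \<Longrightarrow> y \<in> D \<Longrightarrow> x \<squnion> y \<in> D"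
    and neg_closed: "x \<in> D \<Longrightarrow> neg x \<in> D"
    and opp_closed: "x \<in> D \<Longrightarrow> opp x \<in> D"
    and top_closed: "\<top> \<in> D"
    and bot_closed: "\<bottom> \<in> D"
    and ax1a: "x \<in> D \<Longrightarrow> y \<in> D \<Longrightarrow> (x \<sqinter> x) \<sqinter> y = x \<sqinter> y"
    and ax1b: "x \<in> D \<Longrightarrow> y \<in> D \<Longrightarrow> (x \<squnion> x) \<squnion> y = x \<squnion> y"
    and ax2a: "x \<in> D \<Longrightarrow> y \<in> D \<Longrightarrow> x \<sqinter> y = y \<sqinter> x"
    and ax2b: "x \<in> D \<Longrightarrow> y \<in> D \<Longrightarrow> x \<squnion> y = y \<squnion> x"
    and ax3a: "x \<in> D \<Longrightarrow> neg (x \<sqinter> x) = neg x"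
    and ax3b: "x \<in> D \<Longrightarrow> opp (x \<squnion> x) = opp x"
    and ax4a: "x \<in> D \<Longrightarrow> y \<in> D \<Longrightarrow> x \<sqinter> (x \<squnion> y) = x \<sqinter> x"
    and ax4b: "x \<in> D \<Longrightarrow> y \<in> D \<Longrightarrow> x \<squnion> (x \<sqinter> y) = x \<squnion> x"
    and ax5a: "x \<in> D \<Longrightarrow> y \<in> D \<Longrightarrow> z \<in> D \<Longrightarrow> x \<sqinter> (y \<^bold>\<or> z) = (x \<sqinter> y) \<^bold>\<or> (x \<sqinter> z)"
    and ax5b: "x \<in> D \<Longrightarrow> y \<in> D \<Longrightarrow> z \<in> D \<Longrightarrow> x \<squnion> (y \<^bold>\<and> z) = (x \<squnion> y) \<^bold>\<and> (x \<squnion> z)"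
    and ax6a: "x \<in> D \<Longrightarrow> y \<in> D \<Longrightarrow> x \<sqinter> (x \<^bold>\<or> y) = x \<sqinter> x"
    and ax6b: "x \<in> D \<Longrightarrow> y \<in> D \<Longrightarrow> x \<squnion> (x \<^bold>\<and> y) = x \<squnion> x"
    and ax7a: "x \<in> D \<Longrightarrow> y \<in> D \<Longrightarrow> neg (neg (x \<sqinter> y)) = x \<sqinter> y"
    and ax7b: "x \<in> D \<Longrightarrow> y \<in> D \<Longrightarrow> opp (opp (x \<squnion> y)) = x \<squnion> y"
    and ax8a: "x \<in> D \<Longrightarrow> x \<sqinter> neg x = \<bottom>"
    and ax8b: "x \<in> D \<Longrightarrow> x \<squnion> opp x = \<top>"
    and ax9a: "neg \<top> = \<bottom>"
    and ax9b: "opp \<bottom> = \<top>"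
    and ax10a: "x \<in> D \<Longrightarrow> y \<in> D \<Longrightarrow> z \<in> D \<Longrightarrow> x \<sqinter> (y \<sqinter> z) = (x \<sqinter> y) \<sqinter> z"
    and ax10b: "x \<in> D \<Longrightarrow> y \<in> D \<Longrightarrow> z \<in> D \<Longrightarrow> x \<squnion> (y \<squnion> z) = (x \<squnion> y) \<squnion> z"
    and ax11a: "neg \<bottom> = \<top> \<sqinter> \<top>"
    and ax11b: "opp \<top> = \<bottom> \<squnion> \<bottom>"
    and ax12: "x \<in> D \<Longrightarrow> (x \<sqinter> x) \<squnion> (x \<sqinter> x) = (x \<squnion> x) \<sqinter> (x \<squnion> x)"

text \<open>
  In what follows \<open>m, c, z, u\<close> are meet, complement, least and greatest element of \<open>B\<close>, and
  \<open>j', c', z', u'\<close> are join, complement, least and greatest element of \<open>B'\<close>.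
\<close>

definition boolean_retractions ::
    "'a set \<Rightarrow>
     'b set \<Rightarrow> ('b \<Rightarrow> 'b \<Rightarrow> 'b) \<Rightarrow> ('b \<Rightarrow> 'b) \<Rightarrow> 'b \<Rightarrow> 'b \<Rightarrow>
     'c set \<Rightarrow> ('c \<Rightarrow> 'c \<Rightarrow> 'c) \<Rightarrow> ('c \<Rightarrow> 'c) \<Rightarrow> 'c \<Rightarrow> 'c \<Rightarrow>
     ('a \<Rightarrow> 'b) \<Rightarrow> ('b \<Rightarrow> 'a) \<Rightarrow> ('a \<Rightarrow> 'c) \<Rightarrow> ('c \<Rightarrow> 'a) \<Rightarrow> bool" where
  "boolean_retractions A B m c z u B' j' c' z' u' r e r' e' \<longleftrightarrow>
    meet_boolean_algebra B m c z u \<and> join_boolean_algebra B' j' c' z' u' \<and>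
    r \<in> A \<rightarrow> B \<and> e \<in> B \<rightarrow> A \<and> r' \<in> A \<rightarrow> B' \<and> e' \<in> B' \<rightarrow> A \<and>
    (\<forall>b\<in>B. r (e b) = b) \<and> (\<forall>b\<in>B'. r' (e' b) = b)"

definition retraction_conditions ::
    "'a set \<Rightarrow>
     ('b \<Rightarrow> 'b \<Rightarrow> 'b) \<Rightarrow> 'b \<Rightarrow> 'b \<Rightarrow> ('c \<Rightarrow> 'c \<Rightarrow> 'c) \<Rightarrow> 'c \<Rightarrow> 'c \<Rightarrow>
     ('a \<Rightarrow> 'b) \<Rightarrow> ('b \<Rightarrow> 'a) \<Rightarrow> ('a \<Rightarrow> 'c) \<Rightarrow> ('c \<Rightarrow> 'a) \<Rightarrow> bool" where
  "retraction_conditions A m z u j' z' u' r e r' e' \<longleftrightarrow>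
    (\<forall>x\<in>A. e (r (e' (r' x))) = e' (r' (e (r x)))) \<and>
    (\<forall>x\<in>A. \<forall>y\<in>A. e (m (r x) (r (e' (j' (r' x) (r' y))))) = e (r x) \<and>
                  e' (j' (r' x) (r' (e (m (r x) (r y))))) = e' (r' x)) \<and>
    r (e' u') = u \<and> r' (e z) = z'"

end

theory Submission
  imports Defs
begin

text \<open>
  Since \<open>e\<close> and \<open>e'\<close> are injective, the axioms of \<open>\<^bold>A\<close> that involve only \<open>\<sqinter>\<close> and the negation
  are Boolean identities of \<open>B\<close> pulled back along \<open>r\<close> (dually for \<open>B'\<close>), and the axioms linking
  the two halves are (a)--(c): (4a) and (4b) say (b), (12) says (a), and (9a) and (9b) say (c).
  Conversely, in a double Boolean algebra the \<open>\<sqinter>\<close>-idempotent elements form a Boolean algebra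
  with retraction \<open>x \<mapsto> x \<sqinter> x\<close>, and dually the \<open>\<squnion>\<close>-idempotent elements.
\<close>

section \<open>Boolean identities relative to a carrier\<close>

context boolean_algebra_on
begin

text \<open>The axioms come in pairs exchanged by reversing the order, so an identity proved for one
  operation yields its mirror image for the other.\<close>

lemma dual: "boolean_algebra_on B join meet compl \<^bold>1 \<^bold>0"
  by unfold_locales
    ((rule meet_closed join_closed compl_closed zero_closed one_closed meet_assoc meet_commute
        join_assoc join_commute meet_join_distrib join_meet_distrib meet_one join_zero
        meet_compl join_compl; assumption)+)

lemma meet_idem:
  assumes "x \<in> B" shows "x \<^bold>\<and> x = x"
proof -
  have "x \<^bold>\<and> x = (x \<^bold>\<and> x) \<^bold>\<or> (x \<^bold>\<and> \<^bold>- x)"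
    using assms by (simp add: meet_compl join_zero meet_closed)
  also have "\<dots> = x \<^bold>\<and> (x \<^bold>\<or> \<^bold>- x)"
    using assms by (simp add: meet_join_distrib compl_closed)
  finally show ?thesis using assms by (simp add: join_compl meet_one)
qed

lemma meet_zero:
  assumes "x \<in> B" shows "x \<^bold>\<and> \<^bold>0 = \<^bold>0"
proof -
  have "x \<^bold>\<and> \<^bold>0 = (x \<^bold>\<and> x) \<^bold>\<and> \<^bold>- x"
    using assms by (simp add: meet_compl meet_assoc compl_closed)
  then show ?thesis using assms by (simp add: meet_idem meet_compl)
qed

end

context boolean_algebra_on
begin

interpretation dual: boolean_algebra_on B join meet compl "\<^bold>1" "\<^bold>0"
  by (rule dual)

lemmas join_one = dual.meet_zero

lemma join_left_commute:
  assumes "x \<in> B" "y \<in> B" "w \<in> B" shows "x \<^bold>\<or> (y \<^bold>\<or> w) = y \<^bold>\<or> (x \<^bold>\<or> w)"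
  using assms by (metis join_assoc join_commute)

lemma meet_join_absorb:
  assumes "x \<in> B" "y \<in> B" shows "x \<^bold>\<and> (x \<^bold>\<or> y) = x"
proof -
  have "x \<^bold>\<and> (x \<^bold>\<or> y) = (x \<^bold>\<or> \<^bold>0) \<^bold>\<and> (x \<^bold>\<or> y)"
    using assms by (simp add: join_zero)
  also have "\<dots> = x \<^bold>\<or> (y \<^bold>\<and> \<^bold>0)"
    using assms by (simp add: join_meet_distrib[symmetric] zero_closed meet_commute[of y])
  finally show ?thesis using assms by (simp add: meet_zero join_zero)
qed

text \<open>By distributivity the complement of \<open>x\<close> and the element \<open>y\<close>
  both equal their common meet.\<close>

lemma compl_unique:
  assumes "x \<in> B" "y \<in> B" and meet: "x \<^bold>\<and> y = \<^bold>0" and join: "x \<^bold>\<or> y = \<^bold>1"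
  shows "\<^bold>- x = y"
proof -
  have cl: "\<^bold>- x \<in> B" "\<^bold>- x \<^bold>\<and> y \<in> B"
    using assms by (simp_all add: compl_closed meet_closed)
  have "\<^bold>- x = \<^bold>- x \<^bold>\<and> (x \<^bold>\<or> y)"
    using cl by (simp add: join meet_one)
  also have "\<dots> = (\<^bold>- x \<^bold>\<and> x) \<^bold>\<or> (\<^bold>- x \<^bold>\<and> y)"
    using assms cl by (intro meet_join_distrib)
  also have "\<dots> = (y \<^bold>\<and> x) \<^bold>\<or> (y \<^bold>\<and> \<^bold>- x)"
    using assms cl meet_commute meet_compl by metis
  also have "\<dots> = y \<^bold>\<and> (x \<^bold>\<or> \<^bold>- x)"
    using assms cl by (intro meet_join_distrib[symmetric])
  finally show ?thesis using assms by (simp add: join_compl meet_one)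
qed

lemma compl_compl:
  assumes "x \<in> B" shows "\<^bold>- (\<^bold>- x) = x"
  using assms meet_commute[of "\<^bold>- x" x] join_commute[of "\<^bold>- x" x]
  by (intro compl_unique) (simp_all add: compl_closed meet_compl join_compl)

lemma compl_one: "\<^bold>- \<^bold>1 = \<^bold>0"
  using meet_commute[of "\<^bold>1" "\<^bold>0"] join_zero[of "\<^bold>1"]
  by (intro compl_unique) (simp_all add: one_closed zero_closed meet_one)

lemma compl_zero: "\<^bold>- \<^bold>0 = \<^bold>1"
  using compl_compl[OF one_closed] by (simp add: compl_one)

lemma compl_meet:
  assumes "x \<in> B" "y \<in> B" shows "\<^bold>- (x \<^bold>\<and> y) = \<^bold>- x \<^bold>\<or> \<^bold>- y"
proof (rule compl_unique)
  have cl: "\<^bold>- x \<in> B" "\<^bold>- y \<in> B" "x \<^bold>\<and> y \<in> B" "\<^bold>- x \<^bold>\<or> \<^bold>- y \<in> B"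
    using assms by (simp_all add: compl_closed meet_closed join_closed)
  have "(x \<^bold>\<and> y) \<^bold>\<and> \<^bold>- x = y \<^bold>\<and> (x \<^bold>\<and> \<^bold>- x)"
    using assms cl meet_assoc meet_commute by metis
  moreover have "(x \<^bold>\<and> y) \<^bold>\<and> \<^bold>- y = x \<^bold>\<and> (y \<^bold>\<and> \<^bold>- y)"
    using assms cl meet_assoc by metis
  ultimately show "(x \<^bold>\<and> y) \<^bold>\<and> (\<^bold>- x \<^bold>\<or> \<^bold>- y) = \<^bold>0"
    using assms cl by (simp add: meet_join_distrib meet_compl meet_zero join_zero zero_closed)
  have "x \<^bold>\<or> (\<^bold>- x \<^bold>\<or> \<^bold>- y) = \<^bold>- y \<^bold>\<or> (x \<^bold>\<or> \<^bold>- x)"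
    using assms cl join_assoc join_commute by metis
  moreover have "y \<^bold>\<or> (\<^bold>- x \<^bold>\<or> \<^bold>- y) = \<^bold>- x \<^bold>\<or> (y \<^bold>\<or> \<^bold>- y)"
    using assms cl by (intro join_left_commute)
  moreover have "(x \<^bold>\<and> y) \<^bold>\<or> (\<^bold>- x \<^bold>\<or> \<^bold>- y)
      = (x \<^bold>\<or> (\<^bold>- x \<^bold>\<or> \<^bold>- y)) \<^bold>\<and> (y \<^bold>\<or> (\<^bold>- x \<^bold>\<or> \<^bold>- y))"
    using assms cl join_meet_distrib join_commute by metis
  ultimately show "(x \<^bold>\<and> y) \<^bold>\<or> (\<^bold>- x \<^bold>\<or> \<^bold>- y) = \<^bold>1"
    using assms cl by (simp add: join_compl join_one meet_one one_closed)
qed (use assms in \<open>simp_all add: compl_closed meet_closed join_closed\<close>)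

end

section \<open>Operations pulled back along a retraction onto a Boolean algebra\<close>

locale boolean_retraction = boolean_algebra_on +
  fixes A :: "'a set" and r :: "'a \<Rightarrow> 'b" and e :: "'b \<Rightarrow> 'a"
  assumes r_closed: "x \<in> A \<Longrightarrow> r x \<in> B"
    and e_closed: "b \<in> B \<Longrightarrow> e b \<in> A"
    and r_e: "b \<in> B \<Longrightarrow> r (e b) = b"
begin

abbreviation pmeet :: "'a \<Rightarrow> 'a \<Rightarrow> 'a"  (infixl "\<sqinter>" 70) where
  "x \<sqinter> y \<equiv> e (r x \<^bold>\<and> r y)"

abbreviation pneg :: "'a \<Rightarrow> 'a" where
  "pneg x \<equiv> e (\<^bold>- r x)"

lemma e_inject: "a \<in> B \<Longrightarrow> b \<in> B \<Longrightarrow> e a = e b \<longleftrightarrow> a = b"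
  by (metis r_e)

lemmas closed = meet_closed join_closed compl_closed zero_closed one_closed r_closed e_closed

lemma pmeet_idem_left: "x \<in> A \<Longrightarrow> y \<in> A \<Longrightarrow> (x \<sqinter> x) \<sqinter> y = x \<sqinter> y"
  by (simp add: closed r_e meet_idem)

lemma pmeet_commute: "x \<in> A \<Longrightarrow> y \<in> A \<Longrightarrow> x \<sqinter> y = y \<sqinter> x"
  by (simp add: closed meet_commute)

lemma pneg_pmeet_self: "x \<in> A \<Longrightarrow> pneg (x \<sqinter> x) = pneg x"
  by (simp add: closed r_e meet_idem)

text \<open>De Morgan in \<open>B\<close>, once \<open>r_e\<close> has cancelled the inner
  retractions. The derived operation of a double Boolean algebra is thus the pulled-back Boolean
  join, which reduces \<open>pmeet_distrib\<close> to distributivity in \<open>B\<close>.\<close>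

lemma pneg_pmeet_pneg:
  "x \<in> A \<Longrightarrow> y \<in> A \<Longrightarrow> pneg (pneg x \<sqinter> pneg y) = e (r x \<^bold>\<or> r y)"
  by (simp add: closed r_e compl_meet compl_compl)

lemma pmeet_distrib:
  assumes "x \<in> A" "y \<in> A" "w \<in> A"
  shows "x \<sqinter> pneg (pneg y \<sqinter> pneg w) = pneg (pneg (x \<sqinter> y) \<sqinter> pneg (x \<sqinter> w))"
proof -
  have "x \<sqinter> pneg (pneg y \<sqinter> pneg w) = x \<sqinter> e (r y \<^bold>\<or> r w)"
    using assms by (simp only: pneg_pmeet_pneg)
  also have "\<dots> = e (r (x \<sqinter> y) \<^bold>\<or> r (x \<sqinter> w))"
    using assms by (simp add: closed r_e meet_join_distrib)
  also have "\<dots> = pneg (pneg (x \<sqinter> y) \<sqinter> pneg (x \<sqinter> w))"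
    using assms by (intro pneg_pmeet_pneg[symmetric] closed)
  finally show ?thesis .
qed

lemma pmeet_absorb: "x \<in> A \<Longrightarrow> y \<in> A \<Longrightarrow> x \<sqinter> pneg (pneg x \<sqinter> pneg y) = x \<sqinter> x"
  by (simp add: closed r_e compl_meet compl_compl meet_join_absorb meet_idem)

lemma pneg_pneg_pmeet: "x \<in> A \<Longrightarrow> y \<in> A \<Longrightarrow> pneg (pneg (x \<sqinter> y)) = x \<sqinter> y"
  by (simp add: closed r_e compl_compl)

lemma pmeet_pneg: "x \<in> A \<Longrightarrow> x \<sqinter> pneg x = e \<^bold>0"
  by (simp add: closed r_e meet_compl)

lemma pmeet_assoc: "x \<in> A \<Longrightarrow> y \<in> A \<Longrightarrow> w \<in> A \<Longrightarrow> x \<sqinter> (y \<sqinter> w) = (x \<sqinter> y) \<sqinter> w"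
  by (simp add: closed r_e meet_assoc)

end

text \<open>The algebra on \<open>B'\<close> is turned upside down, so that its join takes the role
  of the meet and both halves become instances of the same locale.\<close>

lemma boolean_retractionsE:
  assumes "boolean_retractions A B m c z u B' j' c' z' u' r e r' e'"
  obtains j m' where "boolean_retraction B m j c z u A r e"
    "boolean_retraction B' j' m' c' u' z' A r' e'"
proof -
  from assms obtain j where "boolean_algebra_on B m j c z u"
    by (auto simp: boolean_retractions_def meet_boolean_algebra_def)
  moreover from assms obtain m' where "boolean_algebra_on B' m' j' c' z' u'"
    by (auto simp: boolean_retractions_def join_boolean_algebra_def)
  then have "boolean_algebra_on B' j' m' c' u' z'"
    by (rule boolean_algebra_on.dual)
  ultimately show ?thesis
    using assms
    by (intro that[of j m'])
      (simp_all add: boolean_retractions_def boolean_retraction_def boolean_retraction_axioms_def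
        Pi_iff)
qed

section \<open>When the constructed algebra is a double Boolean algebra\<close>

lemma retraction_algebra_iff:
  assumes "boolean_retractions A B m c z u B' j' c' z' u' r e r' e'"
  shows "double_boolean_algebra A
          (\<lambda>x y. e (m (r x) (r y))) (\<lambda>x y. e' (j' (r' x) (r' y)))
          (\<lambda>x. e (c (r x))) (\<lambda>x. e' (c' (r' x))) (e' u') (e z)
        \<longleftrightarrow> retraction_conditions A m z u j' z' u' r e r' e'" (is "?L \<longleftrightarrow> ?R")
proof -
  obtain j m' where "boolean_retraction B m j c z u A r e"
    and "boolean_retraction B' j' m' c' u' z' A r' e'"
    using assms by (rule boolean_retractionsE)
  then interpret M: boolean_retraction B m j c z u A r e
    + J: boolean_retraction B' j' m' c' u' z' A r' e' .
  show ?thesis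
  proof
    assume ?L
    then interpret double_boolean_algebra A
      "\<lambda>x y. e (m (r x) (r y))" "\<lambda>x y. e' (j' (r' x) (r' y))"
      "\<lambda>x. e (c (r x))" "\<lambda>x. e' (c' (r' x))" "e' u'" "e z" .
    \<comment> \<open>Injectivity of \<open>e\<close> turns \<open>ax9a\<close> into the statement
      that the complement of \<open>r (e' u')\<close> is \<open>z\<close>; complementing once more
      gives \<open>u\<close>.\<close>
    have "r (e' u') = u"
      using ax9a by (metis M.e_inject M.closed J.closed M.compl_compl M.compl_zero)
    moreover have "r' (e z) = z'"
      using ax9b by (metis J.e_inject M.closed J.closed J.compl_compl J.compl_zero)
    moreover have "e (r (e' (r' x))) = e' (r' (e (r x)))" if "x \<in> A" for x
      using that ax12[of x] by (simp add: M.closed J.closed M.r_e J.r_e M.meet_idem J.meet_idem)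
    moreover have "e (m (r x) (r (e' (j' (r' x) (r' y))))) = e (r x)"
      "e' (j' (r' x) (r' (e (m (r x) (r y))))) = e' (r' x)" if "x \<in> A" "y \<in> A" for x y
      using that ax4a[of x y] ax4b[of x y]
      by (simp_all add: M.closed J.closed M.meet_idem J.meet_idem)
    ultimately show ?R
      unfolding retraction_conditions_def by blast
  next
    assume ?R
    then have comm: "\<And>x. x \<in> A \<Longrightarrow> e (r (e' (r' x))) = e' (r' (e (r x)))"
      and absorb: "\<And>x y. x \<in> A \<Longrightarrow> y \<in> A \<Longrightarrow> e (m (r x) (r (e' (j' (r' x) (r' y))))) = e (r x)"
        "\<And>x y. x \<in> A \<Longrightarrow> y \<in> A \<Longrightarrow> e' (j' (r' x) (r' (e (m (r x) (r y))))) = e' (r' x)"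
      and tops: "r (e' u') = u" "r' (e z) = z'"
      unfolding retraction_conditions_def by auto
    show ?L
    proof (rule double_boolean_algebra.intro, goal_cases)
      \<comment> \<open>goals 13, 14 and 29 are axioms (4a), (4b) and (12)\<close>
      case (13 x y)
      then show ?case using absorb(1)[of x y]
        by (simp add: M.closed J.closed J.r_e M.r_e M.meet_idem)
    next
      case (14 x y)
      then show ?case using absorb(2)[of x y]
        by (simp add: M.closed J.closed J.r_e M.r_e J.meet_idem)
    next
      case (29 x)
      then show ?case using comm[of x]
        by (simp add: M.closed J.closed M.r_e J.r_e M.meet_idem J.meet_idem)
    \<comment> \<open>The facts are the identities pulled back from one half. What is left for
      \<open>simp\<close> is closure, \<open>ax9a\<close>, \<open>ax9b\<close>, \<open>ax11a\<close>
      and \<open>ax11b\<close>; the last four use \<open>tops\<close>.\<close>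
    qed (fact M.pmeet_idem_left J.pmeet_idem_left M.pmeet_commute J.pmeet_commute
          M.pneg_pmeet_self J.pneg_pmeet_self M.pmeet_distrib J.pmeet_distrib
          M.pmeet_absorb J.pmeet_absorb M.pneg_pneg_pmeet J.pneg_pneg_pmeet
          M.pmeet_pneg J.pmeet_pneg M.pmeet_assoc J.pmeet_assoc
        | simp add: M.closed J.closed tops M.meet_idem J.meet_idem
          M.compl_one M.compl_zero J.compl_one J.compl_zero M.r_e J.r_e)+
  qed
qed

section \<open>The Boolean algebra of meet-idempotent elements\<close>

context double_boolean_algebra
begin

text \<open>The a-axioms and b-axioms change places, and \<open>ax12\<close> is its own dual with
  the sides swapped.\<close>

lemma dual: "double_boolean_algebra D join meet opp neg \<bottom> \<top>"
  by (rule double_boolean_algebra.intro;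
      (rule meet_closed join_closed neg_closed opp_closed top_closed bot_closed
        ax1a ax1b ax2a ax2b ax3a ax3b ax4a ax4b ax5a ax5b ax6a ax6b ax7a ax7b ax8a ax8b
        ax9a ax9b ax10a ax10b ax11a ax11b ax12[symmetric]; assumption?))

definition meet_skeleton :: "'a set" where
  "meet_skeleton = {x \<in> D. x \<sqinter> x = x}"

lemma meet_mem_skeleton: "x \<in> D \<Longrightarrow> y \<in> D \<Longrightarrow> x \<sqinter> y \<in> meet_skeleton"
  unfolding meet_skeleton_def
  by simp (metis ax1a ax2a ax10a meet_closed)

lemma neg_neg:
  assumes "x \<in> meet_skeleton" shows "neg (neg x) = x"
  using assms ax7a[of x x] by (simp add: meet_skeleton_def)

lemma neg_mem_skeleton:
  assumes "x \<in> D" shows "neg x \<in> meet_skeleton"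
proof -
  \<comment> \<open>Replace \<open>x\<close> by \<open>x \<sqinter> x\<close> using
    \<open>ax3a\<close> and cancel the double negation by \<open>ax7a\<close>. The same two axioms,
    applied to \<open>neg x\<close>, then identify \<open>neg x \<sqinter> neg x\<close> with the
    triple negation.\<close>
  have "neg (neg (neg x)) = neg x"
    using assms by (metis ax3a ax7a)
  then have "neg x \<sqinter> neg x = neg x"
    using assms by (metis ax3a ax7a neg_closed)
  then show ?thesis using assms by (simp add: meet_skeleton_def neg_closed)
qed

lemma bot_mem_skeleton: "\<bottom> \<in> meet_skeleton"
  using meet_mem_skeleton ax8a bot_closed neg_closed by metis

text \<open>By \<open>ax8b\<close>, \<open>\<top>\<close> is \<open>x \<squnion> opp x\<close>,
  which \<open>ax4a\<close> absorbs. Here the join half enters the proof about the meet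
  half.\<close>

lemma meet_top:
  assumes "x \<in> meet_skeleton" shows "x \<sqinter> \<top> = x"
  using assms ax4a[of x "opp x"] by (simp add: meet_skeleton_def ax8b opp_closed)

text \<open>The greatest element is \<open>\<top> \<sqinter> \<top>\<close> because
  \<open>\<top>\<close> need not be meet-idempotent. The Boolean join is \<open>meet_vee\<close> and
  not \<open>join\<close>: by \<open>ax4b\<close> and \<open>ax8a\<close>,
  \<open>x \<squnion> \<bottom>\<close> is \<open>x \<squnion> x\<close>, which may differ from
  \<open>x\<close>.\<close>

lemma boolean_algebra_on_meet_skeleton:
  "boolean_algebra_on meet_skeleton meet meet_vee neg \<bottom> (\<top> \<sqinter> \<top>)"
proof -
  have D: "x \<in> D" if "x \<in> meet_skeleton" for x
    using that by (simp add: meet_skeleton_def)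
  note closed = D meet_mem_skeleton neg_mem_skeleton bot_mem_skeleton meet_closed neg_closed
    top_closed
  have one: "x \<sqinter> (\<top> \<sqinter> \<top>) = x" if "x \<in> meet_skeleton" for x
    using that by (simp add: ax10a closed meet_top)
  show ?thesis
  proof
    fix x y w
    assume [simp]: "x \<in> meet_skeleton" "y \<in> meet_skeleton" "w \<in> meet_skeleton"
    show "(x \<sqinter> y) \<sqinter> w = x \<sqinter> (y \<sqinter> w)"
      by (simp add: ax10a closed)
    show "x \<sqinter> y = y \<sqinter> x" "x \<^bold>\<or> y = y \<^bold>\<or> x"
      by (simp_all add: ax2a closed)
    show "(x \<^bold>\<or> y) \<^bold>\<or> w = x \<^bold>\<or> (y \<^bold>\<or> w)"
      by (simp add: neg_neg ax10a closed)
    show "x \<sqinter> (y \<^bold>\<or> w) = (x \<sqinter> y) \<^bold>\<or> (x \<sqinter> w)"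
      by (simp add: ax5a closed)
    \<comment> \<open>Negating both sides of \<open>ax5a\<close> at the negated elements gives the
      other distributive law, as double negations cancel on the skeleton.\<close>
    have "neg x \<sqinter> (neg y \<^bold>\<or> neg w) = (neg x \<sqinter> neg y) \<^bold>\<or> (neg x \<sqinter> neg w)"
      by (simp add: ax5a closed)
    then show "x \<^bold>\<or> (y \<sqinter> w) = (x \<^bold>\<or> y) \<sqinter> (x \<^bold>\<or> w)"
      by (simp add: neg_neg closed)
    show "x \<sqinter> (\<top> \<sqinter> \<top>) = x"
      by (simp add: one)
    show "x \<^bold>\<or> \<bottom> = x"
      by (simp add: ax11a one neg_neg closed)
    show "x \<sqinter> neg x = \<bottom>" "x \<^bold>\<or> neg x = \<top> \<sqinter> \<top>"
      by (simp_all add: ax8a ax11a closed)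
  qed (simp_all add: closed)
qed

end

section \<open>Every double Boolean algebra arises from its two skeletons\<close>

context double_boolean_algebra
begin

interpretation dual: double_boolean_algebra D join meet opp neg \<bottom> \<top>
  by (rule dual)

text \<open>The join-idempotents are the meet skeleton of the dual algebra, where
  \<open>\<top>\<close> is least; reversing the order restores
  \<open>\<bottom> \<squnion> \<bottom>\<close> as least and \<open>\<top>\<close> as greatest
  element.\<close>

lemma boolean_retractions_skeletons:
  "boolean_retractions D meet_skeleton meet neg \<bottom> (\<top> \<sqinter> \<top>)
    dual.meet_skeleton join opp (\<bottom> \<squnion> \<bottom>) \<top> (\<lambda>x. x \<sqinter> x) id (\<lambda>x. x \<squnion> x) id"
  unfolding boolean_retractions_def meet_boolean_algebra_def join_boolean_algebra_def
  using boolean_algebra_on_meet_skeleton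
    boolean_algebra_on.dual[OF dual.boolean_algebra_on_meet_skeleton]
  by (auto simp: meet_mem_skeleton dual.meet_mem_skeleton)
    (auto simp: meet_skeleton_def dual.meet_skeleton_def)

lemma meet_eq_retract: "x \<in> D \<Longrightarrow> y \<in> D \<Longrightarrow> x \<sqinter> y = (x \<sqinter> x) \<sqinter> (y \<sqinter> y)"
  by (metis ax1a ax2a meet_closed)

end

context double_boolean_algebra
begin

interpretation dual: double_boolean_algebra D join meet opp neg \<bottom> \<top>
  by (rule dual)

lemmas join_eq_retract = dual.meet_eq_retract

text \<open>With inclusions as sections, the commutation condition is \<open>ax12\<close>, the
  absorption conditions are \<open>ax4a\<close> and \<open>ax4b\<close>, and the conditions on the
  constants hold by the choice of \<open>\<top> \<sqinter> \<top>\<close> and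
  \<open>\<bottom> \<squnion> \<bottom>\<close>.\<close>

lemma retraction_conditions_skeletons:
  "retraction_conditions D meet \<bottom> (\<top> \<sqinter> \<top>) join (\<bottom> \<squnion> \<bottom>) \<top>
    (\<lambda>x. x \<sqinter> x) id (\<lambda>x. x \<squnion> x) id"
  unfolding retraction_conditions_def
  by (simp add: ax12 ax4a ax4b meet_closed join_closed
      flip: meet_eq_retract join_eq_retract)

lemma obtains_boolean_retractions:
  "\<exists>(B :: 'a set) m c z u (B' :: 'a set) j' c' z' u' r e r' e'.
    boolean_retractions D B m c z u B' j' c' z' u' r e r' e' \<and>
    retraction_conditions D m z u j' z' u' r e r' e' \<and>
    (\<forall>x\<in>D. \<forall>y\<in>D. x \<sqinter> y = e (m (r x) (r y))) \<and>
    (\<forall>x\<in>D. \<forall>y\<in>D. x \<squnion> y = e' (j' (r' x) (r' y))) \<and>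
    (\<forall>x\<in>D. neg x = e (c (r x))) \<and>
    (\<forall>x\<in>D. opp x = e' (c' (r' x))) \<and>
    \<top> = e' u' \<and> \<bottom> = e z"
  \<comment> \<open>Unification with the first rule fixes all witnesses; the negations then agree by
    \<open>ax3a\<close> and \<open>ax3b\<close>.\<close>
  by (intro exI conjI, rule boolean_retractions_skeletons, rule retraction_conditions_skeletons)
    (simp_all add: ax3a ax3b flip: meet_eq_retract join_eq_retract)

end

theorem theorem5p5:
  fixes A :: "'a set"
    and B :: "'b set" and m :: "'b \<Rightarrow> 'b \<Rightarrow> 'b" and c :: "'b \<Rightarrow> 'b" and z u :: 'b
    and B' :: "'c set" and j' :: "'c \<Rightarrow> 'c \<Rightarrow> 'c" and c' :: "'c \<Rightarrow> 'c" and z' u' :: 'c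
    and r :: "'a \<Rightarrow> 'b" and e :: "'b \<Rightarrow> 'a" and r' :: "'a \<Rightarrow> 'c" and e' :: "'c \<Rightarrow> 'a"
    and D :: "'d set" and meet join :: "'d \<Rightarrow> 'd \<Rightarrow> 'd" and neg opp :: "'d \<Rightarrow> 'd" and top bot :: 'd
  shows
    "(boolean_retractions A B m c z u B' j' c' z' u' r e r' e' \<longrightarrow>
       (double_boolean_algebra A
          (\<lambda>x y. e (m (r x) (r y))) (\<lambda>x y. e' (j' (r' x) (r' y)))
          (\<lambda>x. e (c (r x))) (\<lambda>x. e' (c' (r' x))) (e' u') (e z)
        \<longleftrightarrow> retraction_conditions A m z u j' z' u' r e r' e'))
     \<and>
     (double_boolean_algebra D meet join neg opp top bot \<longrightarrow>
       (\<exists>(B :: 'd set) m c z u (B' :: 'd set) j' c' z' u' r e r' e'.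
          boolean_retractions D B m c z u B' j' c' z' u' r e r' e' \<and>
          retraction_conditions D m z u j' z' u' r e r' e' \<and>
          (\<forall>x\<in>D. \<forall>y\<in>D. meet x y = e (m (r x) (r y))) \<and>
          (\<forall>x\<in>D. \<forall>y\<in>D. join x y = e' (j' (r' x) (r' y))) \<and>
          (\<forall>x\<in>D. neg x = e (c (r x))) \<and>
          (\<forall>x\<in>D. opp x = e' (c' (r' x))) \<and>
          top = e' u' \<and> bot = e z))"
  using retraction_algebra_iff double_boolean_algebra.obtains_boolean_retractions
  by (intro conjI impI)

end
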